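(* For any symplectic matrix $H\in\mathbb{R}^{2d\times 2d}$ there exists a symmetric $S\in\mathbb{R}^{d\times d}$ such that, for all real $\lambda\neq 0$, the factorization $$H=\begin{bmatrix} I & \lambda S \\ 0 & I \end{bmatrix}\begin{bmatrix} P_{\lambda} & \star \\ \star & \star \end{bmatrix}$$ holds with a nonsingular $P_{\lambda}\in\mathbb{R}^{d\times d}$. Hence any symplectic matrix can be decomposed into the product of a unit upper triangular symplectic matrix and a symplectic matrix with nonsingular left upper block. Furthermore, if the left upper $d\times d$ block $A_1$ of $H$ has rank $r$ and is decomposed as $A_{1}=P\begin{bmatrix} I_{r} & 0 \\ 0 & O_{d-r} \end{bmatrix}Q$ with $P,Q\in\mathbb{R}^{d\times d}$ nonsingular, then $S$ can be taken to be $$S=-P\begin{bmatrix} O_{r} & 0 \\ 0 & I_{d-r} \end{bmatrix}P^{T}.$$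
   Context: Let $I=I_d$ and $J=\begin{bmatrix} 0 & I_{d} \\ -I_{d} & 0 \end{bmatrix}$. A matrix $H\in\mathbb{R}^{2d\times 2d}$ is symplectic if $H^{T}JH=J$. All $2\times2$ block matrices have $d\times d$ blocks; $O_k$ is the $k\times k$ zero matrix. The symbol $\star$ denotes unspecified blocks. A unit upper triangular symplectic matrix is one of the form $\begin{bmatrix} I & S \\ 0 & I\end{bmatrix}$ with $S\in\mathbb{R}^{d\times d}$ symmetric. *)

theory Defs
  imports Jordan_Normal_Form.DL_Rank
begin

definition J_mat :: "nat \<Rightarrow> real mat" where
  "J_mat d = four_block_mat (0\<^sub>m d d) (1\<^sub>m d) (- 1\<^sub>m d) (0\<^sub>m d d)"

definition symplectic_mat :: "nat \<Rightarrow> real mat \<Rightarrow> bool" where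
  "symplectic_mat d H \<longleftrightarrow>
     H \<in> carrier_mat (2 * d) (2 * d) \<and> transpose_mat H * J_mat d * H = J_mat d"

definition symmetric_mat :: "nat \<Rightarrow> real mat \<Rightarrow> bool" where
  "symmetric_mat d S \<longleftrightarrow> S \<in> carrier_mat d d \<and> transpose_mat S = S"

definition upper_unit :: "nat \<Rightarrow> real mat \<Rightarrow> real mat" where
  "upper_unit d S = four_block_mat (1\<^sub>m d) S (0\<^sub>m d d) (1\<^sub>m d)"

definition unit_upper_triangular_symplectic :: "nat \<Rightarrow> real mat \<Rightarrow> bool" where
  "unit_upper_triangular_symplectic d U \<longleftrightarrow> (\<exists>S. symmetric_mat d S \<and> U = upper_unit d S)"

definition left_upper_block :: "nat \<Rightarrow> real mat \<Rightarrow> real mat" where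
  "left_upper_block d H = mat d d (\<lambda>ij. H $$ ij)"

definition nonsingular_mat :: "nat \<Rightarrow> real mat \<Rightarrow> bool" where
  "nonsingular_mat d P \<longleftrightarrow> P \<in> carrier_mat d d \<and> invertible_mat P"

text \<open>The existentially quantified blocks \<open>X\<close>, \<open>Y\<close>, \<open>Z\<close> are the unspecified
  blocks of the right factor; like \<open>P\<close>, they may depend on the scalar \<open>c\<close>,
  whereas \<open>S\<close> does not.\<close>

definition factorizes_for_all_scalars :: "nat \<Rightarrow> real mat \<Rightarrow> real mat \<Rightarrow> bool" where
  "factorizes_for_all_scalars d H S \<longleftrightarrow>
     (\<forall>c::real. c \<noteq> 0 \<longrightarrow>
       (\<exists>P X Y Z. nonsingular_mat d P \<and>
          X \<in> carrier_mat d d \<and> Y \<in> carrier_mat d d \<and> Z \<in> carrier_mat d d \<and>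
          H = upper_unit d (c \<cdot>\<^sub>m S) * four_block_mat P X Y Z))"

end

theory Submission
  imports Defs
begin

text \<open>Write \<open>H\<close> in blocks \<open>A, B, C, D\<close>. The left upper block of the right factor must be
  \<open>A - \<lambda> S C\<close>. Suppose that the ranges of \<open>A\<close> and the symmetric matrix \<open>S\<close> meet only in 0 and
  that \<open>A\<^sup>T\<close> and \<open>S\<close> have no common kernel. If \<open>A v = \<lambda> S C v\<close>, then \<open>A v = 0\<close> and \<open>S C v = 0\<close>,
  so \<open>A\<^sup>T C v = C\<^sup>T A v = 0\<close>, hence \<open>C v = 0\<close>, and \<open>v = (D\<^sup>T A - B\<^sup>T C) v = 0\<close>.
  Such an \<open>S\<close> always exists: choose a maximal set of linearly independent rows of \<open>A\<close> and let \<open>S\<close> be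
  the coordinate projection onto the remaining indices.\<close>

text \<open>Since \<open>S\<close> is symmetric, a common kernel of \<open>transpose_mat A\<close>
  and \<open>S\<close> is the orthogonal complement of the sum of the two ranges. The conditions
  together thus say that the range of \<open>S\<close> is a direct complement of the range of
  \<open>A\<close>, phrased with vectors only so that no dimension count is involved.\<close>

definition complementary_mat :: "nat \<Rightarrow> real mat \<Rightarrow> real mat \<Rightarrow> bool" where
  "complementary_mat d A S \<longleftrightarrow> symmetric_mat d S \<and>
     (\<forall>x\<in>carrier_vec d. \<forall>y\<in>carrier_vec d. A *\<^sub>v x = S *\<^sub>v y \<longrightarrow> S *\<^sub>v y = 0\<^sub>v d) \<and>
     (\<forall>z\<in>carrier_vec d. transpose_mat A *\<^sub>v z = 0\<^sub>v d \<longrightarrow> S *\<^sub>v z = 0\<^sub>v d \<longrightarrow> z = 0\<^sub>v d)"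

section \<open>Block form of the symplectic condition\<close>

lemma four_block_mat_inject:
  assumes A: "A \<in> carrier_mat m n" "A' \<in> carrier_mat m n"
    and B: "B \<in> carrier_mat m l" "B' \<in> carrier_mat m l"
    and C: "C \<in> carrier_mat k n" "C' \<in> carrier_mat k n"
    and D: "D \<in> carrier_mat k l" "D' \<in> carrier_mat k l"
    and eq: "four_block_mat A B C D = four_block_mat A' B' C' D'"
  shows "A = A'" "B = B'" "C = C'" "D = D'"
proof -
  have e: "four_block_mat A B C D $$ (i, j) = four_block_mat A' B' C' D' $$ (i, j)" for i j
    using eq by simp
  show "A = A'"
  proof (rule eq_matI)
    fix i j assume "i < dim_row A'" "j < dim_col A'"
    then show "A $$ (i, j) = A' $$ (i, j)" using e[of i j] A D by simp
  qed (use A in auto)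
  show "B = B'"
  proof (rule eq_matI)
    fix i j assume "i < dim_row B'" "j < dim_col B'"
    then show "B $$ (i, j) = B' $$ (i, j)" using e[of i "n + j"] A B D by simp
  qed (use B in auto)
  show "C = C'"
  proof (rule eq_matI)
    fix i j assume "i < dim_row C'" "j < dim_col C'"
    then show "C $$ (i, j) = C' $$ (i, j)" using e[of "m + i" j] A C D by simp
  qed (use C in auto)
  show "D = D'"
  proof (rule eq_matI)
    fix i j assume "i < dim_row D'" "j < dim_col D'"
    then show "D $$ (i, j) = D' $$ (i, j)" using e[of "m + i" "n + j"] A D by simp
  qed (use D in auto)
qed

lemma left_upper_block_four_block:
  assumes "A \<in> carrier_mat d d" "D \<in> carrier_mat d d"
  shows "left_upper_block d (four_block_mat A B C D) = A"
  using assms by (intro eq_matI) (auto simp: left_upper_block_def)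

text \<open>This computation serves twice: it yields the block relations of a given symplectic
  matrix, and it confirms that \<open>upper_unit d S\<close> is symplectic for symmetric
  \<open>S\<close>.\<close>

lemma J_mat_conj_blocks:
  assumes A: "A \<in> carrier_mat d d" and B: "B \<in> carrier_mat d d"
    and C: "C \<in> carrier_mat d d" and D: "D \<in> carrier_mat d d"
  shows "transpose_mat (four_block_mat A B C D) * J_mat d * four_block_mat A B C D =
    four_block_mat (transpose_mat A * C - transpose_mat C * A) (transpose_mat A * D - transpose_mat C * B)
      (transpose_mat B * C - transpose_mat D * A) (transpose_mat B * D - transpose_mat D * B)"
proof -
  note car = transpose_carrier_mat[THEN iffD2] A B C D
  have neg: "X * (- 1\<^sub>m d) = - X" if "X \<in> carrier_mat d d" for X :: "real mat"
    using that by (metis one_carrier_mat right_mult_one_mat uminus_mult_right_mat carrier_matD)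
  have "transpose_mat (four_block_mat A B C D) * J_mat d =
    four_block_mat (- transpose_mat C) (transpose_mat A) (- transpose_mat D) (transpose_mat B)"
    unfolding transpose_four_block_mat[OF A B C D] J_mat_def
    using car
    by (subst mult_four_block_mat[where ?nr1.0 = d and ?n1.0 = d and ?n2.0 = d and ?nr2.0 = d and ?nc1.0 = d and ?nc2.0 = d])
      (auto simp: neg)
  moreover have "- (X * Y) + Z = Z - X * Y"
    if "X \<in> carrier_mat d d" "Y \<in> carrier_mat d d" "Z \<in> carrier_mat d d" for X Y Z :: "real mat"
    using that by (intro eq_matI) auto
  ultimately show ?thesis
    using car
    by (simp, subst mult_four_block_mat[where ?nr1.0 = d and ?n1.0 = d and ?n2.0 = d and ?nr2.0 = d and ?nc1.0 = d and ?nc2.0 = d])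
      (auto simp: uminus_mult_left_mat)
qed

text \<open>Both relations come from comparing the first block column of the conjugated matrix with
  that of \<open>J_mat d\<close>. The first lets \<open>A v = 0\<close> pass to
  \<open>transpose_mat A\<close> applied to \<open>C v\<close>; the second recovers \<open>v\<close>
  from \<open>A v\<close> and \<open>C v\<close>.\<close>

lemma symplectic_mat_blocks:
  assumes A: "A \<in> carrier_mat d d" and B: "B \<in> carrier_mat d d"
    and C: "C \<in> carrier_mat d d" and D: "D \<in> carrier_mat d d"
    and H: "symplectic_mat d (four_block_mat A B C D)"
  shows "transpose_mat A * C - transpose_mat C * A = 0\<^sub>m d d"
    and "transpose_mat B * C - transpose_mat D * A = - 1\<^sub>m d"
proof -
  have car: "transpose_mat X * Y - transpose_mat Z * W \<in> carrier_mat d d"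
    if "X \<in> carrier_mat d d" "Y \<in> carrier_mat d d" "Z \<in> carrier_mat d d" "W \<in> carrier_mat d d"
    for X Y Z W :: "real mat"
    using that by (auto intro!: minus_carrier_mat)
  have neg1: "- 1\<^sub>m d \<in> carrier_mat d d" by simp
  have eq: "four_block_mat (transpose_mat A * C - transpose_mat C * A) (transpose_mat A * D - transpose_mat C * B)
      (transpose_mat B * C - transpose_mat D * A) (transpose_mat B * D - transpose_mat D * B) =
    four_block_mat (0\<^sub>m d d) (1\<^sub>m d) (- 1\<^sub>m d) (0\<^sub>m d d)"
    using H unfolding symplectic_mat_def J_mat_conj_blocks[OF A B C D] by (simp add: J_mat_def)
  note inject = four_block_mat_inject[OF car[OF A C C A] zero_carrier_mat car[OF A D C B] one_carrier_mat
      car[OF B C D A] neg1 car[OF B D D B] zero_carrier_mat eq]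
  show "transpose_mat A * C - transpose_mat C * A = 0\<^sub>m d d" by (rule inject(1))
  show "transpose_mat B * C - transpose_mat D * A = - 1\<^sub>m d" by (rule inject(3))
qed

section \<open>Nonsingularity as triviality of the kernel\<close>

lemma nonsingular_matI:
  assumes M: "M \<in> carrier_mat d d"
    and ker: "\<And>v. v \<in> carrier_vec d \<Longrightarrow> M *\<^sub>v v = 0\<^sub>v d \<Longrightarrow> v = 0\<^sub>v d"
  shows "nonsingular_mat d M"
proof -
  have "det M \<noteq> 0" using ker det_0_iff_vec_prod_zero_field[OF M] by blast
  \<comment> \<open>A unit of the ring of square matrices has a two-sided inverse of the same size.
    The argument \<open>()\<close> fills the record extension of that ring.\<close>
  from det_non_zero_imp_unit[OF M this, of "()"]
  obtain N where "N \<in> carrier_mat d d" "N * M = 1\<^sub>m d" "M * N = 1\<^sub>m d"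
    unfolding Units_def by (auto simp: ring_mat_simps)
  then show ?thesis using M
    unfolding nonsingular_mat_def invertible_mat_def inverts_mat_def by auto
qed

lemma nonsingular_mat_kernel:
  assumes "nonsingular_mat d M" and v: "v \<in> carrier_vec d" and "M *\<^sub>v v = 0\<^sub>v d"
  shows "v = 0\<^sub>v d"
proof -
  from assms obtain N where M: "M \<in> carrier_mat d d" and MN: "M * N = 1\<^sub>m d" and NM: "N * M = 1\<^sub>m (dim_row N)"
    unfolding nonsingular_mat_def invertible_mat_def inverts_mat_def by auto
  \<comment> \<open>\<open>invertible_mat\<close> does not fix the shape of the inverse. Comparing
    column counts in \<open>M * N\<close> gives the columns of \<open>N\<close>, and in
    \<open>N * M\<close> its rows.\<close>
  have N: "N \<in> carrier_mat d d"
    using arg_cong[OF MN, of dim_col] arg_cong[OF NM, of dim_col] M by auto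
  have "v = (N * M) *\<^sub>v v" using NM N v by simp
  also have "\<dots> = N *\<^sub>v (M *\<^sub>v v)" using N M v by simp
  also have "\<dots> = 0\<^sub>v d" using assms(3) N by auto
  finally show ?thesis .
qed

lemma nonsingular_mat_transpose:
  assumes "nonsingular_mat d M"
  shows "nonsingular_mat d (transpose_mat M)"
proof -
  from assms have M: "M \<in> carrier_mat d d" unfolding nonsingular_mat_def by simp
  have "det M \<noteq> 0"
    using det_0_iff_vec_prod_zero_field[OF M] nonsingular_mat_kernel[OF assms] by blast
  then have "det (transpose_mat M) \<noteq> 0" using det_transpose[OF M] by simp
  then show ?thesis
    using M det_0_iff_vec_prod_zero_field[of "transpose_mat M" d] by (intro nonsingular_matI) auto
qed

section \<open>The right factor and its left upper block\<close>

text \<open>The inverse of \<open>upper_unit d T\<close> is \<open>upper_unit d (- T)\<close>;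
  multiplying by it from the left subtracts \<open>T\<close> times the lower block row from the
  upper one and keeps the lower one.\<close>

lemma upper_unit_factor:
  assumes A: "A \<in> carrier_mat d d" and B: "B \<in> carrier_mat d d"
    and C: "C \<in> carrier_mat d d" and D: "D \<in> carrier_mat d d"
    and T: "T \<in> carrier_mat d d"
  shows "four_block_mat A B C D = upper_unit d T * four_block_mat (A - T * C) (B - T * D) C D"
proof -
  have cancel: "X - Y + Y = X" if "X \<in> carrier_mat d d" "Y \<in> carrier_mat d d" for X Y :: "real mat"
    using that by (intro eq_matI) auto
  have car: "A - T * C \<in> carrier_mat d d" "B - T * D \<in> carrier_mat d d"
    "T * C \<in> carrier_mat d d" "T * D \<in> carrier_mat d d"
    using assms by (auto intro!: minus_carrier_mat)
  show ?thesis unfolding upper_unit_def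
    using assms car
    by (subst mult_four_block_mat[where ?nr1.0 = d and ?n1.0 = d and ?n2.0 = d and ?nr2.0 = d and ?nc1.0 = d and ?nc2.0 = d])
      (auto simp: cancel)
qed

lemma complementary_mat_nonsingular:
  assumes A: "A \<in> carrier_mat d d" and B: "B \<in> carrier_mat d d"
    and C: "C \<in> carrier_mat d d" and D: "D \<in> carrier_mat d d"
    and H: "symplectic_mat d (four_block_mat A B C D)"
    and S: "complementary_mat d A S" and c: "c \<noteq> 0"
  shows "nonsingular_mat d (A - (c \<cdot>\<^sub>m S) * C)"
proof (rule nonsingular_matI)
  from S have Sc: "S \<in> carrier_mat d d" unfolding complementary_mat_def symmetric_mat_def by simp
  show "A - (c \<cdot>\<^sub>m S) * C \<in> carrier_mat d d" using Sc C by (auto intro!: minus_carrier_mat)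
  fix v :: "real vec" assume v: "v \<in> carrier_vec d" and "(A - (c \<cdot>\<^sub>m S) * C) *\<^sub>v v = 0\<^sub>v d"
  \<comment> \<open>The scalar is moved from the matrix to the vector, so that the conditions on the
    unscaled \<open>S\<close> apply to \<open>w\<close>.\<close>
  define w where "w = c \<cdot>\<^sub>v (C *\<^sub>v v)"
  have w: "w \<in> carrier_vec d" unfolding w_def using C v by auto
  have AvS: "A *\<^sub>v v \<in> carrier_vec d" "S *\<^sub>v w \<in> carrier_vec d" using A Sc v w by auto
  have "(A - (c \<cdot>\<^sub>m S) * C) *\<^sub>v v = A *\<^sub>v v - ((c \<cdot>\<^sub>m S) * C) *\<^sub>v v"
    by (rule minus_mult_distrib_mat_vec[OF A _ v]) (use Sc C in auto)
  also have "((c \<cdot>\<^sub>m S) * C) *\<^sub>v v = S *\<^sub>v w"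
  proof -
    have "((c \<cdot>\<^sub>m S) * C) *\<^sub>v v = (c \<cdot>\<^sub>m S) *\<^sub>v (C *\<^sub>v v)"
      by (rule assoc_mult_mat_vec) (use Sc C v in auto)
    also have "\<dots> = S *\<^sub>v w" unfolding w_def
      using Sc C v by (subst mult_mat_vec[OF Sc]) (auto intro!: eq_vecI simp: smult_scalar_prod_distrib)
    finally show ?thesis .
  qed
  finally have "A *\<^sub>v v - S *\<^sub>v w = 0\<^sub>v d"
    using \<open>(A - (c \<cdot>\<^sub>m S) * C) *\<^sub>v v = 0\<^sub>v d\<close> by simp
  then have eq: "A *\<^sub>v v = S *\<^sub>v w"
    using AvS A by (auto simp: vec_eq_iff)
  then have Sw: "S *\<^sub>v w = 0\<^sub>v d" using S v w unfolding complementary_mat_def by blast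
  then have Av: "A *\<^sub>v v = 0\<^sub>v d" using eq by simp
  have At: "transpose_mat A * C \<in> carrier_mat d d" "transpose_mat C * A \<in> carrier_mat d d"
    "transpose_mat B * C \<in> carrier_mat d d" "transpose_mat D * A \<in> carrier_mat d d"
    using A B C D by auto
  have z: "(0\<^sub>m d d :: real mat) *\<^sub>v v = 0\<^sub>v d" using v by auto
  \<comment> \<open>The symmetry of \<open>transpose_mat A * C\<close> turns this vector into
    \<open>transpose_mat C\<close> applied to \<open>A v\<close>, which vanishes.\<close>
  have "transpose_mat A *\<^sub>v (C *\<^sub>v v) = 0\<^sub>v d"
  proof -
    have "0\<^sub>v d = (transpose_mat A * C - transpose_mat C * A) *\<^sub>v v"
      unfolding symplectic_mat_blocks(1)[OF A B C D H] z ..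
    also have "\<dots> = transpose_mat A *\<^sub>v (C *\<^sub>v v) - transpose_mat C *\<^sub>v (A *\<^sub>v v)"
      using A C v At by (subst minus_mult_distrib_mat_vec[OF At(1,2) v]) auto
    also have "\<dots> = transpose_mat A *\<^sub>v (C *\<^sub>v v)"
      unfolding Av using A C v by auto
    finally show ?thesis by simp
  qed
  then have "transpose_mat A *\<^sub>v w = 0\<^sub>v d"
    unfolding w_def using A C v by (subst mult_mat_vec[where nr = d and nc = d]) auto
  then have "w = 0\<^sub>v d" using S Sw w unfolding complementary_mat_def by blast
  \<comment> \<open>Here the scalar has to be nonzero: \<open>w\<close> is \<open>c\<close> times
    \<open>C v\<close>.\<close>
  then have Cv: "C *\<^sub>v v = 0\<^sub>v d"
    unfolding w_def using c C v by (auto simp: vec_eq_iff)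
  have "- v = (transpose_mat B * C - transpose_mat D * A) *\<^sub>v v"
    unfolding symplectic_mat_blocks(2)[OF A B C D H] using v by auto
  also have "\<dots> = transpose_mat B *\<^sub>v (C *\<^sub>v v) - transpose_mat D *\<^sub>v (A *\<^sub>v v)"
    using A B C D v At by (subst minus_mult_distrib_mat_vec[OF At(3,4) v]) auto
  also have "\<dots> = 0\<^sub>v d"
    unfolding Av Cv using B D by auto
  finally show "v = 0\<^sub>v d" using v uminus_zero_vec_eq by blast
qed

section \<open>Existence of a complementary symmetric matrix\<close>

lemma complementary_mat_exists:
  assumes A: "A \<in> carrier_mat d d"
  shows "\<exists>S. complementary_mat d A S"
proof -
  \<comment> \<open>A vector \<open>z\<close> supported on \<open>I\<close> with
    \<open>transpose_mat A\<close> sending it to zero is a linear relation among the rows of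
    \<open>A\<close> indexed by \<open>I\<close>. So for index sets below \<open>d\<close>,
    \<open>indep I\<close> says that these rows are linearly independent.\<close>
  define indep where "indep I \<longleftrightarrow> (\<forall>z\<in>carrier_vec d. transpose_mat A *\<^sub>v z = 0\<^sub>v d \<longrightarrow>
      (\<forall>i<d. i \<notin> I \<longrightarrow> z $ i = 0) \<longrightarrow> z = 0\<^sub>v d)" for I
  have "indep {}" unfolding indep_def by (auto simp: vec_eq_iff)
  then have "{I. I \<subseteq> {..<d} \<and> indep I} \<noteq> {}" by blast
  then obtain I where I: "I \<subseteq> {..<d}" "indep I"
    and max: "\<And>I'. I' \<subseteq> {..<d} \<Longrightarrow> indep I' \<Longrightarrow> I \<subseteq> I' \<Longrightarrow> I = I'"
    using finite_has_maximal[of "{I. I \<subseteq> {..<d} \<and> indep I}"] by auto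
  define S :: "real mat" where "S = mat d d (\<lambda>(i, j). if i = j \<and> i \<notin> I then 1 else 0)"
  have Sv: "(S *\<^sub>v z) $ i = (if i \<in> I then 0 else z $ i)" if "z \<in> carrier_vec d" "i < d" for z i
  proof -
    have "(S *\<^sub>v z) $ i = (\<Sum>j<d. (if i = j \<and> i \<notin> I then 1 else 0) * z $ j)"
      unfolding S_def using that by (auto simp: scalar_prod_def lessThan_atLeast0 intro!: sum.cong)
    also have "\<dots> = (\<Sum>j<d. if j = i then (if i \<notin> I then z $ i else 0) else 0)"
      by (intro sum.cong) auto
    also have "\<dots> = (if i \<in> I then 0 else z $ i)" using that by simp
    finally show ?thesis .
  qed
  have Sc: "S \<in> carrier_mat d d" unfolding S_def by simp
  have "symmetric_mat d S" unfolding symmetric_mat_def S_def by (auto intro!: eq_matI)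
  moreover have "S *\<^sub>v y = 0\<^sub>v d"
    if x: "x \<in> carrier_vec d" and y: "y \<in> carrier_vec d" and eq: "A *\<^sub>v x = S *\<^sub>v y" for x y
  proof -
    have "(A *\<^sub>v x) $ j = 0" if j: "j < d" for j
    proof (cases "j \<in> I")
      case True
      then show ?thesis using eq Sv[OF y j] by simp
    next
      case False
      \<comment> \<open>By maximality, adding row \<open>j\<close> creates a nontrivial relation
        \<open>z\<close>. Its coefficient at \<open>j\<close> is nonzero, as otherwise it would be a
        relation among the independent rows in \<open>I\<close>.\<close>
      then have "\<not> indep (insert j I)" using max[of "insert j I"] I(1) j by auto
      then obtain z where z: "z \<in> carrier_vec d" "transpose_mat A *\<^sub>v z = 0\<^sub>v d" "z \<noteq> 0\<^sub>v d"
        and supp: "\<And>i. i < d \<Longrightarrow> i \<notin> insert j I \<Longrightarrow> z $ i = 0"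
        unfolding indep_def by blast
      have zj: "z $ j \<noteq> 0"
      proof
        assume "z $ j = 0"
        then have "\<forall>i<d. i \<notin> I \<longrightarrow> z $ i = 0" using supp by (metis insert_iff)
        then show False using I(2) z unfolding indep_def by blast
      qed
      \<comment> \<open>The relation \<open>z\<close> is orthogonal to the range of
        \<open>A\<close>, in particular to \<open>A x\<close>.\<close>
      have "0 = (transpose_mat A *\<^sub>v z) \<bullet> x" using z x by simp
      also have "\<dots> = z \<bullet> (A *\<^sub>v x)"
        by (rule transpose_vec_mult_scalar[OF A x z(1)])
      also have "\<dots> = (\<Sum>i<d. z $ i * (A *\<^sub>v x) $ i)"
        using A by (simp add: scalar_prod_def lessThan_atLeast0)
      \<comment> \<open>For \<open>i\<close> in \<open>I\<close> the entry of
        \<open>A x = S y\<close> vanishes because \<open>S\<close> erases these coordinates; outside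
        \<open>insert j I\<close> the entry of \<open>z\<close> vanishes. Only the term at
        \<open>j\<close> survives, so entry \<open>j\<close> of \<open>A x\<close> must be
        zero.\<close>
      also have "\<dots> = (\<Sum>i<d. if i = j then z $ j * (A *\<^sub>v x) $ j else 0)"
      proof (intro sum.cong refl)
        fix i assume i: "i \<in> {..<d}"
        have "(A *\<^sub>v x) $ i = 0" if "i \<in> I" unfolding eq using Sv[OF y] i that by simp
        then show "z $ i * (A *\<^sub>v x) $ i = (if i = j then z $ j * (A *\<^sub>v x) $ j else 0)"
          using supp[of i] i by (cases "i \<in> I") auto
      qed
      also have "\<dots> = z $ j * (A *\<^sub>v x) $ j" using j by simp
      finally show ?thesis using zj by simp
    qed
    then show ?thesis using A unfolding eq[symmetric] by (intro eq_vecI) auto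
  qed
  moreover have "z = 0\<^sub>v d"
    if z: "z \<in> carrier_vec d" and "transpose_mat A *\<^sub>v z = 0\<^sub>v d" and Sz: "S *\<^sub>v z = 0\<^sub>v d" for z
  proof -
    \<comment> \<open>Vanishing of \<open>S z\<close> means that \<open>z\<close> is supported on
      \<open>I\<close>, so \<open>z\<close> is a relation among independent rows.\<close>
    have "\<forall>i<d. i \<notin> I \<longrightarrow> z $ i = 0" using Sv[OF z] Sz by (metis index_zero_vec(1))
    then show ?thesis using I(2) that unfolding indep_def by blast
  qed
  ultimately show ?thesis unfolding complementary_mat_def by blast
qed

section \<open>Both factorizations from a complementary matrix\<close>

lemma complementary_mat_factorizes:
  assumes H: "symplectic_mat d H" and S: "complementary_mat d (left_upper_block d H) S"
  shows "factorizes_for_all_scalars d H S"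
    and "\<exists>U K. unit_upper_triangular_symplectic d U \<and> symplectic_mat d K \<and>
        nonsingular_mat d (left_upper_block d K) \<and> H = U * K"
proof -
  obtain A B C D where sb: "split_block H d d = (A, B, C, D)" by (metis prod_cases4)
  have dim: "dim_row H = d + d" "dim_col H = d + d" using H unfolding symplectic_mat_def by auto
  note A = split_block(1)[OF sb dim] and B = split_block(2)[OF sb dim]
    and C = split_block(3)[OF sb dim] and D = split_block(4)[OF sb dim]
    and Heq = split_block(5)[OF sb dim]
  have "complementary_mat d A S"
    using S unfolding Heq left_upper_block_four_block[OF A D] .
  note ns = complementary_mat_nonsingular[OF A B C D H[unfolded Heq] this]
  have Ssym: "symmetric_mat d S" using S unfolding complementary_mat_def by simp
  then have Sc: "S \<in> carrier_mat d d" unfolding symmetric_mat_def by simp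
  note fac = upper_unit_factor[OF A B C D, folded Heq]
  show "factorizes_for_all_scalars d H S"
    unfolding factorizes_for_all_scalars_def
  proof (intro allI impI exI conjI)
    fix c :: real assume "c \<noteq> 0"
    then show "nonsingular_mat d (A - (c \<cdot>\<^sub>m S) * C)" by (rule ns)
    show "H = upper_unit d (c \<cdot>\<^sub>m S) * four_block_mat (A - (c \<cdot>\<^sub>m S) * C) (B - (c \<cdot>\<^sub>m S) * D) C D"
      by (rule fac) (use Sc in simp)
  qed (use B C D Sc in \<open>auto intro!: minus_carrier_mat\<close>)
  define U where "U = upper_unit d S"
  define K where "K = four_block_mat (A - S * C) (B - S * D) C D"
  have car: "A - S * C \<in> carrier_mat d d" "B - S * D \<in> carrier_mat d d"
    using A B C D Sc by (auto intro!: minus_carrier_mat)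
  have HUK: "H = U * K" unfolding U_def K_def by (rule fac[OF Sc])
  have Uc: "U \<in> carrier_mat (d + d) (d + d)" unfolding U_def upper_unit_def by simp
  have Kc: "K \<in> carrier_mat (d + d) (d + d)" unfolding K_def using car D by simp
  have Jc: "J_mat d \<in> carrier_mat (d + d) (d + d)" unfolding J_mat_def by simp
  have "transpose_mat U * J_mat d * U = J_mat d"
    unfolding U_def upper_unit_def
    using Ssym Sc by (subst J_mat_conj_blocks) (auto simp: J_mat_def symmetric_mat_def intro!: eq_matI)
  \<comment> \<open>Since \<open>U\<close> preserves \<open>J_mat d\<close>, the form can be
    replaced by its conjugate under \<open>U\<close>. The product then regroups into the conjugate
    under \<open>U * K = H\<close>.\<close>
  then have "transpose_mat K * J_mat d * K = transpose_mat K * (transpose_mat U * J_mat d * U) * K"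
    by simp
  also have "\<dots> = transpose_mat H * J_mat d * H"
    unfolding HUK transpose_mult[OF Uc Kc] using Uc Kc Jc
    by (simp add: assoc_mult_mat[where n\<^sub>1 = "d + d" and n\<^sub>2 = "d + d" and n\<^sub>3 = "d + d" and n\<^sub>4 = "d + d"])
  also have "\<dots> = J_mat d" using H unfolding symplectic_mat_def by simp
  finally have "symplectic_mat d K" unfolding symplectic_mat_def using Kc by (simp add: mult_2)
  \<comment> \<open>The decomposition into \<open>U\<close> and \<open>K\<close> is the case of
    scalar 1.\<close>
  moreover have "1 \<cdot>\<^sub>m S = S" by (intro eq_matI) auto
  then have "nonsingular_mat d (left_upper_block d K)"
    using ns[of 1] unfolding K_def left_upper_block_four_block[OF car(1) D] by simp
  moreover have "unit_upper_triangular_symplectic d U"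
    unfolding U_def unit_upper_triangular_symplectic_def using Ssym by blast
  ultimately show "\<exists>U K. unit_upper_triangular_symplectic d U \<and> symplectic_mat d K \<and>
        nonsingular_mat d (left_upper_block d K) \<and> H = U * K"
    using HUK by blast
qed

section \<open>The explicit matrix obtained from a rank decomposition\<close>

text \<open>\<open>E\<close> and \<open>F\<close> are complementary orthogonal projections. As
  \<open>Q\<close> and \<open>transpose_mat P\<close> are invertible, the two products have as
  ranges the images under \<open>P\<close> of the ranges of \<open>E\<close> and \<open>F\<close>,
  and the injective \<open>P\<close> keeps these complementary. Stating this for abstract
  projections confines the block computations to checking a few identities.\<close>

lemma complementary_mat_projections:
  assumes P: "nonsingular_mat d P" and Q: "nonsingular_mat d Q"
    and E: "E \<in> carrier_mat d d" "transpose_mat E = E"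
    and F: "F \<in> carrier_mat d d" "transpose_mat F = F" "F * F = F"
    and FE: "F * E = 0\<^sub>m d d" and sum: "E + F = 1\<^sub>m d"
  shows "complementary_mat d (P * E * Q) (- (P * F * transpose_mat P))"
proof -
  have Pc: "P \<in> carrier_mat d d" "transpose_mat P \<in> carrier_mat d d"
    and Qc: "Q \<in> carrier_mat d d" "transpose_mat Q \<in> carrier_mat d d"
    using P Q unfolding nonsingular_mat_def by auto
  note car = Pc Qc E(1) F(1)
  define S where "S = - (P * F * transpose_mat P)"
  have Sc: "S \<in> carrier_mat d d" unfolding S_def using car by auto
  have Sv: "S *\<^sub>v y = - (P *\<^sub>v (F *\<^sub>v (transpose_mat P *\<^sub>v y)))" if "y \<in> carrier_vec d" for y
    unfolding S_def using car that
    by (simp add: assoc_mult_mat_vec[where n\<^sub>1 = d and n\<^sub>2 = d and n\<^sub>3 = d])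
  have Av: "(P * E * Q) *\<^sub>v x = P *\<^sub>v (E *\<^sub>v (Q *\<^sub>v x))" if "x \<in> carrier_vec d" for x
    using car that by (simp add: assoc_mult_mat_vec[where n\<^sub>1 = d and n\<^sub>2 = d and n\<^sub>3 = d])
  have "transpose_mat (P * E * Q) = transpose_mat Q * (transpose_mat E * transpose_mat P)"
    using car by (simp add: transpose_mult[where nr = d and n = d and nc = d])
  then have Atv: "transpose_mat (P * E * Q) *\<^sub>v z = transpose_mat Q *\<^sub>v (E *\<^sub>v (transpose_mat P *\<^sub>v z))"
    if "z \<in> carrier_vec d" for z
    using car that E(2) by (simp add: assoc_mult_mat_vec[where n\<^sub>1 = d and n\<^sub>2 = d and n\<^sub>3 = d])
  have "transpose_mat (P * F * transpose_mat P) = P * (F * transpose_mat P)"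
    using car F(2) by (simp add: transpose_mult[where nr = d and n = d and nc = d])
  then have "transpose_mat S = S"
    unfolding S_def transpose_uminus using car
    by (simp add: assoc_mult_mat[where n\<^sub>1 = d and n\<^sub>2 = d and n\<^sub>3 = d and n\<^sub>4 = d])
  then have "symmetric_mat d S" unfolding symmetric_mat_def using Sc by simp
  moreover have "S *\<^sub>v y = 0\<^sub>v d"
    if x: "x \<in> carrier_vec d" and y: "y \<in> carrier_vec d" and eq: "(P * E * Q) *\<^sub>v x = S *\<^sub>v y" for x y
  proof -
    define a where "a = E *\<^sub>v (Q *\<^sub>v x)"
    define b where "b = F *\<^sub>v (transpose_mat P *\<^sub>v y)"
    have ab: "a \<in> carrier_vec d" "b \<in> carrier_vec d" "Q *\<^sub>v x \<in> carrier_vec d"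
      "transpose_mat P *\<^sub>v y \<in> carrier_vec d"
      unfolding a_def b_def using car x y by auto
    have "P *\<^sub>v a = - (P *\<^sub>v b)" using eq unfolding Sv[OF y] Av[OF x] a_def b_def .
    then have "P *\<^sub>v (a + b) = 0\<^sub>v d"
      using Pc ab by (simp add: mult_add_distrib_mat_vec[where nr = d and nc = d])
    then have "a + b = 0\<^sub>v d" using nonsingular_mat_kernel[OF P] ab by auto
    \<comment> \<open>Applying \<open>F\<close> separates the two summands: it kills
      \<open>a\<close>, which lies in the range of \<open>E\<close>, and fixes \<open>b\<close>,
      which lies in its own range.\<close>
    then have "F *\<^sub>v a + F *\<^sub>v b = 0\<^sub>v d"
      using F(1) ab by (auto simp flip: mult_add_distrib_mat_vec[where nr = d and nc = d])
    moreover have "0\<^sub>m d d *\<^sub>v (Q *\<^sub>v x) = 0\<^sub>v d" using ab(3) by auto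
    then have "F *\<^sub>v a = 0\<^sub>v d"
      using assoc_mult_mat_vec[OF F(1) E(1) ab(3)] unfolding FE a_def by simp
    moreover have "F *\<^sub>v b = b"
      using assoc_mult_mat_vec[OF F(1) F(1) ab(4)] unfolding F(3) b_def by simp
    ultimately have "b = 0\<^sub>v d" using ab by simp
    then show ?thesis unfolding Sv[OF y] b_def[symmetric] using Pc by auto
  qed
  moreover have "z = 0\<^sub>v d"
    if z: "z \<in> carrier_vec d" and At: "transpose_mat (P * E * Q) *\<^sub>v z = 0\<^sub>v d"
      and S0: "S *\<^sub>v z = 0\<^sub>v d" for z
  proof -
    define u where "u = transpose_mat P *\<^sub>v z"
    have u: "u \<in> carrier_vec d" "E *\<^sub>v u \<in> carrier_vec d" "F *\<^sub>v u \<in> carrier_vec d"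
      unfolding u_def using car z by auto
    have "E *\<^sub>v u = 0\<^sub>v d"
      using At nonsingular_mat_kernel[OF nonsingular_mat_transpose[OF Q] u(2)]
      unfolding Atv[OF z] u_def[symmetric] by simp
    moreover have "P *\<^sub>v (F *\<^sub>v u) = 0\<^sub>v d"
      using S0 Pc u(3) uminus_zero_vec_eq[of "P *\<^sub>v (F *\<^sub>v u)" d]
      unfolding Sv[OF z] u_def[symmetric] by auto
    then have "F *\<^sub>v u = 0\<^sub>v d" using nonsingular_mat_kernel[OF P u(3)] by simp
    \<comment> \<open>Both components of \<open>u\<close> vanish, the first by injectivity of
      \<open>transpose_mat Q\<close> and the second by that of \<open>P\<close>; since
      \<open>E + F\<close> is the identity, they add up to \<open>u\<close>.\<close>
    moreover have "u = E *\<^sub>v u + F *\<^sub>v u"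
      using add_mult_distrib_mat_vec[OF E(1) F(1) u(1)] u(1) unfolding sum by simp
    ultimately have "u = 0\<^sub>v d" by simp
    then show ?thesis
      using nonsingular_mat_kernel[OF nonsingular_mat_transpose[OF P] z] unfolding u_def by simp
  qed
  ultimately show ?thesis unfolding complementary_mat_def S_def by blast
qed

theorem theorem7:
  fixes d :: nat and H :: "real mat"
  assumes "symplectic_mat d H"
  shows
    "(\<exists>S. symmetric_mat d S \<and> factorizes_for_all_scalars d H S) \<and>
     (\<exists>U K. unit_upper_triangular_symplectic d U \<and> symplectic_mat d K \<and>
        nonsingular_mat d (left_upper_block d K) \<and> H = U * K) \<and>
     (\<forall>r P Q S.
        vec_space.rank d (left_upper_block d H) = r \<and>
        nonsingular_mat d P \<and> nonsingular_mat d Q \<and>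
        left_upper_block d H =
          P * four_block_mat (1\<^sub>m r) (0\<^sub>m r (d - r)) (0\<^sub>m (d - r) r) (0\<^sub>m (d - r) (d - r)) * Q \<and>
        S = - (P * four_block_mat (0\<^sub>m r r) (0\<^sub>m r (d - r)) (0\<^sub>m (d - r) r) (1\<^sub>m (d - r))
                 * transpose_mat P) \<longrightarrow>
        symmetric_mat d S \<and> factorizes_for_all_scalars d H S)"
proof (intro conjI allI impI)
  obtain S where S: "complementary_mat d (left_upper_block d H) S"
    using complementary_mat_exists[of "left_upper_block d H" d] unfolding left_upper_block_def by auto
  then show "\<exists>S. symmetric_mat d S \<and> factorizes_for_all_scalars d H S"
    using complementary_mat_factorizes(1)[OF assms S] unfolding complementary_mat_def by blast
  show "\<exists>U K. unit_upper_triangular_symplectic d U \<and> symplectic_mat d K \<and>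
        nonsingular_mat d (left_upper_block d K) \<and> H = U * K"
    by (rule complementary_mat_factorizes(2)[OF assms S])
next
  fix r P Q S
  let ?E = "four_block_mat (1\<^sub>m r) (0\<^sub>m r (d - r)) (0\<^sub>m (d - r) r) (0\<^sub>m (d - r) (d - r)) :: real mat"
  let ?F = "four_block_mat (0\<^sub>m r r) (0\<^sub>m r (d - r)) (0\<^sub>m (d - r) r) (1\<^sub>m (d - r)) :: real mat"
  assume *: "vec_space.rank d (left_upper_block d H) = r \<and>
        nonsingular_mat d P \<and> nonsingular_mat d Q \<and> left_upper_block d H = P * ?E * Q \<and>
        S = - (P * ?F * transpose_mat P)"
  have "left_upper_block d H \<in> carrier_mat d d" unfolding left_upper_block_def by simp
  \<comment> \<open>Subtraction on \<open>nat\<close> is truncated, so the rank bound is what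
    ensures \<open>r + (d - r) = d\<close>, that is, that \<open>?E\<close> and \<open>?F\<close>
    are \<open>d\<close> by \<open>d\<close> matrices.\<close>
  then have r: "r \<le> d" using vec_space.rank_le_nc * by blast
  have "complementary_mat d (P * ?E * Q) (- (P * ?F * transpose_mat P))"
  proof (rule complementary_mat_projections)
    \<comment> \<open>The products are computed blockwise; symmetry and the sum of \<open>?E\<close>
      and \<open>?F\<close> are checked entrywise afterwards.\<close>
    show "?F * ?F = ?F" "?F * ?E = 0\<^sub>m d d"
      using r by (subst mult_four_block_mat[where ?nr1.0 = r and ?n1.0 = r and ?n2.0 = "d - r" and ?nr2.0 = "d - r"
            and ?nc1.0 = r and ?nc2.0 = "d - r"]; simp)+
  qed (use * r in \<open>auto intro!: eq_matI\<close>)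
  then have S: "complementary_mat d (left_upper_block d H) S" using * by simp
  then show "symmetric_mat d S" unfolding complementary_mat_def by simp
  show "factorizes_for_all_scalars d H S" by (rule complementary_mat_factorizes(1)[OF assms S])
qed

end
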